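(* Let $n$ be a natural number with $n\geq 51$ and let $\alpha\in(0,1)$. Then $$|A_{2n-1}(\alpha,e^{i\theta})|\leq|A_{2n-1}(\alpha,1)|\quad\text{for all }\theta\in\left[-\frac{2\pi}{3},-\frac{\pi}{2}\right]\cup\left[\frac{\pi}{2},\frac{2\pi}{3}\right].$$
   Context: For $\alpha>0$ and $x\in\mathbb{C}$ with $|x|=1$, the numbers $A_m(\alpha,x)$ are the coefficients of the Maclaurin expansion $$\frac{(1+xz)^\alpha}{1-z}=\sum_{m=0}^\infty A_m(\alpha,x)z^m,\qquad |z|<1,$$ where the power is the principal branch. Equivalently, $A_m(\alpha,x)=\sum_{k=0}^{m}\frac{(-\alpha)_k(-x)^k}{k!}$, where $(a)_0=1$ and $(a)_k=a(a+1)\cdots(a+k-1)$ for $k\ge 1$. *)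

theory Defs
  imports "HOL-Complex_Analysis.Complex_Analysis"
begin

definition A_coeff :: "nat \<Rightarrow> real \<Rightarrow> complex \<Rightarrow> complex" where
  "A_coeff m \<alpha> x = fps_nth (fps_expansion (\<lambda>z. (1 + x * z) powr of_real \<alpha> / (1 - z)) 0) m"

lemma A_coeff_genfun_sums:
  assumes "norm x = 1" "norm z < 1"
  shows "(\<lambda>m. A_coeff m \<alpha> x * z ^ m) sums ((1 + x * z) powr of_real \<alpha> / (1 - z))"
proof -
  let ?f = "\<lambda>z. (1 + x * z) powr of_real \<alpha> / (1 - z)"
  have "?f holomorphic_on eball 0 1"
  proof (intro holomorphic_intros)
    fix w :: complex assume "w \<in> eball 0 1"
    hence w: "norm w < 1" by simp
    thus "1 - w \<noteq> 0" by auto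
    have "norm (x * w) < 1" using w assms by (simp add: norm_mult)
    hence "Re (1 + x * w) > 0" using abs_Re_le_cmod[of "x * w"] by simp
    thus "1 + x * w \<notin> \<real>\<^sub>\<le>\<^sub>0" by (auto simp only: complex_nonpos_Reals_iff)
  qed
  moreover have "ball 0 1 = (eball 0 1 :: complex set)" by (simp add: one_ereal_def)
  ultimately have "?f holomorphic_on ball 0 1" by simp
  from holomorphic_power_series[OF this, of z] show ?thesis
    using assms by (simp add: A_coeff_def fps_expansion_def)
qed

lemma A_coeff_conv_sum:
  "A_coeff m \<alpha> x = (\<Sum>k\<le>m. pochhammer (- of_real \<alpha>) k * (- x) ^ k / fact k)"
proof -
  have "((\<lambda>z. (1 + z) powr of_real \<alpha>) \<circ> (\<lambda>z. x * z)) has_fps_expansion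
          (fps_binomial (of_real \<alpha>) oo (fps_const x * fps_X))"
    by (intro has_fps_expansion_compose fps_expansion_intros) auto
  hence "(\<lambda>z. (1 + x * z) powr of_real \<alpha> * inverse (1 - z)) has_fps_expansion
          (fps_binomial (of_real \<alpha>) oo (fps_const x * fps_X)) * inverse (1 - fps_X)"
    by (intro fps_expansion_intros) (auto simp: o_def)
  hence "fps_expansion (\<lambda>z. (1 + x * z) powr of_real \<alpha> * inverse (1 - z)) 0 =
          (fps_binomial (of_real \<alpha>) oo (fps_const x * fps_X)) * inverse (1 - fps_X)"
    by (rule fps_expansion_eqI)
  also have "inverse (1 - fps_X) = (Abs_fps (\<lambda>_. 1) :: complex fps)"
    by (metis fps_inverse_gp' fps_inverse_idempotent fps_nth_Abs_fps one_neq_zero)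
  finally have "A_coeff m \<alpha> x = (\<Sum>k\<le>m. x ^ k * (of_real \<alpha> gchoose k))"
    by (simp add: A_coeff_def divide_inverse fps_mult_nth fps_compose_linear atLeast0AtMost)
  thus ?thesis
    by (simp add: gbinomial_pochhammer power_minus[of x] mult_ac)
qed

end

(* On the unit circle (1 + x)^\<alpha> - A_m(\<alpha>, x) is the tail of the binomial series. Its coefficients
   alternate in sign, decrease in modulus and satisfy |binom(\<alpha>, k)| <= \<alpha>/k, so summation by parts
   bounds the tail by 2\<alpha> / ((m + 1) |1 + x|). For the \<theta> in question 1 <= |1 + x| <= sqrt 2, and
   2^\<alpha> - 2^(\<alpha>/2) >= \<alpha> (ln 2) / 2 exceeds the sum of the tails at x and at 1. *)
theory Submission
  imports Defs
begin

lemma A_coeff_eq_sum_gbinomial: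
  "A_coeff m \<alpha> x = (\<Sum>k\<le>m. of_real (\<alpha> gchoose k) * x ^ k)"
  unfolding A_coeff_conv_sum
  by (rule sum.cong) (simp_all add: gbinomial_pochhammer power_minus[of x] flip: pochhammer_of_real)

context
  fixes \<alpha> :: real
  assumes \<alpha>: "0 < \<alpha>" "\<alpha> < 1"
begin

lemma abs_gbinomial_Suc:
  assumes "k \<ge> 1"
  shows "\<bar>\<alpha> gchoose Suc k\<bar> = \<bar>\<alpha> gchoose k\<bar> * (real k - \<alpha>) / (real k + 1)"
proof -
  have "(\<alpha> gchoose Suc k) = (\<alpha> gchoose k) * (\<alpha> - real k) / (real k + 1)"
    using gbinomial_mult_1[of \<alpha> k] by (simp add: field_simps)
  moreover have "\<bar>\<alpha> - real k\<bar> = real k - \<alpha>" using \<alpha> assms by simp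
  ultimately show ?thesis by (simp add: abs_mult)
qed

text \<open>From k = 1 on, consecutive coefficients have ratio (\<alpha> - k)/(k + 1), which lies in
  (-1, 0), so adding neighbours subtracts their moduli. In this form the differences telescope in
  the summation by parts.\<close>

lemma abs_gbinomial_add_Suc:
  assumes "k \<ge> 1"
  shows "\<bar>(\<alpha> gchoose k) + (\<alpha> gchoose Suc k)\<bar> = \<bar>\<alpha> gchoose k\<bar> - \<bar>\<alpha> gchoose Suc k\<bar>"
proof -
  have "(\<alpha> gchoose k) + (\<alpha> gchoose Suc k) = (\<alpha> gchoose k) * ((\<alpha> + 1) / (real k + 1))"
    using gbinomial_mult_1[of \<alpha> k] by (simp add: field_simps)
  hence "\<bar>(\<alpha> gchoose k) + (\<alpha> gchoose Suc k)\<bar> = \<bar>\<alpha> gchoose k\<bar> * ((\<alpha> + 1) / (real k + 1))"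
    using \<alpha> by (simp add: abs_mult)
  thus ?thesis by (simp add: abs_gbinomial_Suc[OF assms] field_simps)
qed

text \<open>The product of k and the modulus of the k-th coefficient does not increase with k and
  equals \<alpha> at k = 1.\<close>

lemma abs_gbinomial_le:
  assumes "k \<ge> 1"
  shows "\<bar>\<alpha> gchoose k\<bar> \<le> \<alpha> / real k"
  using assms
proof (induction k rule: dec_induct)
  case base
  then show ?case using \<alpha> by simp
next
  case (step k)
  have "\<bar>\<alpha> gchoose Suc k\<bar> \<le> \<alpha> / real k * real k / (real k + 1)"
    unfolding abs_gbinomial_Suc[OF step.hyps(1)]
    using \<alpha> step by (intro divide_right_mono mult_mono) auto
  then show ?case using step.hyps by (simp add: add.commute)
qed

text \<open>Summation by parts: multiplying by 1 + z replaces the inner coefficients by sums of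
  neighbours, whose moduli telescope. The bound depends neither on M nor on z.\<close>

lemma norm_gbinomial_block_le:
  fixes z :: complex
  assumes "norm z \<le> 1" "m < M"
  shows "norm ((1 + z) * (\<Sum>k\<in>{m<..M}. of_real (\<alpha> gchoose k) * z ^ k))
           \<le> 2 * \<bar>\<alpha> gchoose Suc m\<bar>"
proof -
  let ?b = "\<lambda>k. \<alpha> gchoose k"
  let ?S = "\<lambda>M. \<Sum>k\<in>{m<..M}. of_real (?b k) * z ^ k"
  have pow: "norm (of_real a * z ^ k) \<le> \<bar>a\<bar>" for a k
    using assms(1) by (simp add: norm_mult norm_power mult_left_le power_le_one)
  have "Suc m \<le> M" using assms by simp
  \<comment> \<open>Strengthened for the induction: the boundary term at M is split off and the
    bound keeps the slack \<open>- \<bar>?b M\<bar>\<close>. Each step turns this slack into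
    \<open>- \<bar>?b (Suc M)\<bar>\<close>; at the end it pays for putting the boundary term
    back.\<close>
  hence "norm ((1 + z) * ?S M - of_real (?b M) * z ^ Suc M) \<le> 2 * \<bar>?b (Suc m)\<bar> - \<bar>?b M\<bar>"
  proof (induction M rule: dec_induct)
    case base
    have "{m<..Suc m} = {Suc m}" by auto
    then show ?case using pow[of "?b (Suc m)" "Suc m"] by (simp add: algebra_simps)
  next
    case (step M)
    have "{m<..Suc M} = insert (Suc M) {m<..M}" using step.hyps by auto
    hence "(1 + z) * ?S (Suc M) - of_real (?b (Suc M)) * z ^ Suc (Suc M)
        = ((1 + z) * ?S M - of_real (?b M) * z ^ Suc M)
          + of_real (?b M + ?b (Suc M)) * z ^ Suc M"
      by (simp add: algebra_simps)
    also have "norm \<dots> \<le> (2 * \<bar>?b (Suc m)\<bar> - \<bar>?b M\<bar>) + \<bar>?b M + ?b (Suc M)\<bar>"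
      by (intro norm_triangle_mono step.IH pow)
    finally show ?case using abs_gbinomial_add_Suc[of M] step.hyps by simp
  qed
  moreover have "norm (of_real (?b M) * z ^ Suc M) \<le> \<bar>?b M\<bar>" by (rule pow)
  ultimately show ?thesis
    using norm_triangle_ineq2[of "(1 + z) * ?S M" "of_real (?b M) * z ^ Suc M"] by linarith
qed

text \<open>Inside the disc the binomial series converges to the power, so the uniform block bound
  survives M tending to infinity.\<close>

lemma norm_gbinomial_remainder_le_ball:
  fixes z :: complex
  assumes "norm z < 1"
  shows "norm ((1 + z) * ((1 + z) powr of_real \<alpha> - (\<Sum>k\<le>m. of_real (\<alpha> gchoose k) * z ^ k)))
           \<le> 2 * \<bar>\<alpha> gchoose Suc m\<bar>"
proof -
  let ?s = "\<lambda>M. \<Sum>k\<le>M. of_real (\<alpha> gchoose k) * z ^ k"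
  have "?s \<longlonglongrightarrow> (1 + z) powr of_real \<alpha>"
    using gen_binomial_complex[OF assms, of "of_real \<alpha>"]
    by (simp add: sums_def_le gbinomial_pochhammer flip: pochhammer_of_real)
  hence "(\<lambda>M. norm ((1 + z) * (?s M - ?s m)))
           \<longlonglongrightarrow> norm ((1 + z) * ((1 + z) powr of_real \<alpha> - ?s m))"
    by (intro tendsto_intros)
  moreover have "norm ((1 + z) * (?s M - ?s m)) \<le> 2 * \<bar>\<alpha> gchoose Suc m\<bar>" if "M > m" for M
  proof -
    have "{..M} = {..m} \<union> {m<..M}" using that by auto
    hence "?s M - ?s m = (\<Sum>k\<in>{m<..M}. of_real (\<alpha> gchoose k) * z ^ k)"
      by (simp add: sum.union_disjoint ivl_disj_int)
    thus ?thesis using norm_gbinomial_block_le[OF less_imp_le[OF assms] that] by simp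
  qed
  ultimately show ?thesis
    by (intro tendsto_upperbound) (auto intro: eventually_mono[OF eventually_gt_at_top[of m]])
qed

text \<open>The bound inside the disc does not depend on z, so it passes to the circle along the
  radius r x as r tends to 1 from below. Convergence of the series on the circle itself never
  enters.\<close>

lemma norm_gbinomial_remainder_le_circle:
  fixes x :: complex
  assumes "norm x = 1" "x \<noteq> -1"
  shows "norm ((1 + x) * ((1 + x) powr of_real \<alpha> - (\<Sum>k\<le>m. of_real (\<alpha> gchoose k) * x ^ k)))
           \<le> 2 * \<bar>\<alpha> gchoose Suc m\<bar>"
proof -
  let ?F = "\<lambda>z::complex. norm ((1 + z) *
    ((1 + z) powr of_real \<alpha> - (\<Sum>k\<le>m. of_real (\<alpha> gchoose k) * z ^ k)))"
  \<comment> \<open>The principal branch is continuous at 1 + x off the cut; on the unit circle only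
    x = -1 puts 1 + x on it.\<close>
  have "1 + x \<notin> \<real>\<^sub>\<le>\<^sub>0"
  proof
    assume "1 + x \<in> \<real>\<^sub>\<le>\<^sub>0"
    hence "Im x = 0" "Re x \<le> -1" by (auto simp: complex_nonpos_Reals_iff)
    with abs_Re_le_cmod[of x] assms show False by (auto simp: complex_eq_iff)
  qed
  hence "isCont ?F x" by (intro continuous_intros) auto
  moreover have "((\<lambda>r. of_real r * x) \<longlongrightarrow> of_real 1 * x) (at_left (1::real))"
    by (intro tendsto_intros)
  ultimately have "((\<lambda>r. ?F (of_real r * x)) \<longlongrightarrow> ?F x) (at_left (1::real))"
    by (intro isCont_tendsto_compose[of x ?F]) auto
  moreover have "eventually (\<lambda>r. r \<in> {0<..<1}) (at_left (1::real))"
    by (intro eventually_at_left_real) simp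
  hence "eventually (\<lambda>r. ?F (of_real r * x) \<le> 2 * \<bar>\<alpha> gchoose Suc m\<bar>) (at_left (1::real))"
    by (rule eventually_mono, intro norm_gbinomial_remainder_le_ball)
       (use assms in \<open>simp add: norm_mult\<close>)
  ultimately show ?thesis by (intro tendsto_upperbound) auto
qed

lemma norm_powr_minus_A_coeff_le:
  assumes "norm x = 1" "norm (1 + x) \<ge> 1"
  shows "norm ((1 + x) powr of_real \<alpha> - A_coeff m \<alpha> x) \<le> 2 * \<alpha> / (real m + 1)"
proof -
  let ?d = "norm ((1 + x) powr of_real \<alpha> - A_coeff m \<alpha> x)"
  have "x \<noteq> -1" using assms(2) by auto
  have "1 * ?d \<le> norm (1 + x) * ?d"
    using assms by (intro mult_right_mono) auto
  also have "\<dots> \<le> 2 * \<bar>\<alpha> gchoose Suc m\<bar>"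
    using norm_gbinomial_remainder_le_circle[OF assms(1) \<open>x \<noteq> -1\<close>, of m]
    by (simp only: A_coeff_eq_sum_gbinomial norm_mult)
  also have "\<dots> \<le> 2 * (\<alpha> / real (Suc m))"
    by (intro mult_left_mono abs_gbinomial_le) auto
  finally show ?thesis by (simp add: add.commute)
qed

text \<open>With u = 2^(\<alpha>/2) the difference is u (u - 1) >= u - 1, and exp t >= 1 + t with ln
  2 >= 1/2 gives u - 1 >= \<alpha>/4.\<close>

lemma two_powr_minus_sqrt_two_powr_ge:
  "2 powr \<alpha> - sqrt 2 powr \<alpha> \<ge> \<alpha> / 4"
proof -
  define u where "u = sqrt 2 powr \<alpha>"
  have u: "u = 2 powr (\<alpha> / 2)" by (simp add: u_def powr_powr flip: powr_half_sqrt)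
  have sq: "2 powr \<alpha> = u * u" by (simp add: u flip: powr_add)
  have "ln 2 \<ge> (1/2 :: real)"
    using ln_le_minus_one[of "1/2"] by (simp add: ln_div)
  hence "\<alpha> / 2 * (1 / 2) \<le> \<alpha> / 2 * ln 2"
    using \<alpha> by (intro mult_left_mono) auto
  hence "1 + \<alpha> / 4 \<le> 1 + \<alpha> / 2 * ln 2" by simp
  also have "\<dots> \<le> u" unfolding u powr_def by simp
  finally have u_ge: "1 + \<alpha> / 4 \<le> u" .
  hence "1 * (u - 1) \<le> u * (u - 1)"
    using \<alpha> by (intro mult_right_mono) auto
  with sq u_ge show ?thesis unfolding u_def[symmetric] by (simp add: algebra_simps)
qed

end

lemma norm_one_add_cis: "norm (1 + cis \<theta>) = sqrt (2 + 2 * cos \<theta>)"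
proof -
  have "(1 + cos \<theta>)\<^sup>2 + (sin \<theta>)\<^sup>2 = 2 + 2 * cos \<theta>"
    using sin_cos_squared_add[of \<theta>] by (simp add: power2_eq_square algebra_simps)
  thus ?thesis by (simp add: cmod_def)
qed

theorem theorem2:
  fixes n :: nat and \<alpha> :: real
  assumes "n \<ge> 51" and "\<alpha> \<in> {0<..<1}"
  shows "\<forall>\<theta> \<in> {-(2 * pi / 3)..-(pi / 2)} \<union> {pi / 2..2 * pi / 3}.
           cmod (A_coeff (2 * n - 1) \<alpha> (exp (\<i> * complex_of_real \<theta>)))
             \<le> cmod (A_coeff (2 * n - 1) \<alpha> 1)"
proof
  fix \<theta> :: real
  assume "\<theta> \<in> {-(2 * pi / 3)..-(pi / 2)} \<union> {pi / 2..2 * pi / 3}"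
  \<comment> \<open>Cosine is even, so both intervals are treated at once; there -1/2 <= cos
    \<theta> <= 0, which puts 2 + 2 cos \<theta> between 1 and 2.\<close>
  hence \<theta>: "\<bar>\<theta>\<bar> \<in> {pi / 2..2 * pi / 3}" by auto
  have \<alpha>: "0 < \<alpha>" "\<alpha> < 1" using assms(2) by auto
  let ?x = "cis \<theta>" and ?m = "2 * n - 1"
  have "cos (2 * pi / 3) \<le> cos \<bar>\<theta>\<bar>" "cos \<bar>\<theta>\<bar> \<le> cos (pi / 2)"
    using \<theta> by (intro cos_monotone_0_pi_le; simp)+
  hence "norm (1 + ?x) \<le> sqrt 2" "norm (1 + ?x) \<ge> 1"
    by (simp_all add: norm_one_add_cis cos_120)
  moreover from this have "norm (1 + ?x) powr \<alpha> \<le> sqrt 2 powr \<alpha>"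
    using \<alpha> by (intro powr_mono2) auto
  moreover have "norm ((1 + ?x) powr of_real \<alpha>) = norm (1 + ?x) powr \<alpha>"
    by (simp add: norm_powr_real_powr')
  ultimately have x: "norm (A_coeff ?m \<alpha> ?x) \<le> sqrt 2 powr \<alpha> + 2 * \<alpha> / (real ?m + 1)"
    using norm_powr_minus_A_coeff_le[OF \<alpha>, of ?x ?m]
      norm_triangle_ineq3[of "(1 + ?x) powr of_real \<alpha>" "A_coeff ?m \<alpha> ?x"] by simp
  have "norm ((1 + 1 :: complex) powr of_real \<alpha>) = 2 powr \<alpha>"
    by (simp add: norm_powr_real_powr')
  hence one: "norm (A_coeff ?m \<alpha> 1) \<ge> 2 powr \<alpha> - 2 * \<alpha> / (real ?m + 1)"
    using norm_powr_minus_A_coeff_le[OF \<alpha>, of 1 ?m]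
      norm_triangle_ineq2[of "(1 + 1) powr of_real \<alpha>" "A_coeff ?m \<alpha> 1"] by simp
  \<comment> \<open>Here \<open>real ?m + 1\<close> is 2n >= 102. The value 16 makes each of the two
    tails at most \<alpha>/8, so together they fit into the gap \<alpha>/4.\<close>
  have "2 * \<alpha> / (real ?m + 1) \<le> 2 * \<alpha> / 16"
    using assms(1) \<alpha> by (intro divide_left_mono) auto
  with x one two_powr_minus_sqrt_two_powr_ge[OF \<alpha>]
  show "cmod (A_coeff ?m \<alpha> (exp (\<i> * complex_of_real \<theta>))) \<le> cmod (A_coeff ?m \<alpha> 1)"
    by (simp add: cis_conv_exp)
qed

end
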